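(* Let $X=NA$ be a harmonic $NA$ group (Damek–Ricci space), including the rank one Riemannian symmetric spaces of noncompact type, but excluding the real hyperbolic spaces. Let $N_X:=N$, let $Z_X$ be the center of $N_X$, set $\sigma=\frac{\dim N_X+\dim Z_X}{2}$ and $\beta=\frac{\dim Z_X-1}{2}$. For $\lambda\in\mathbb{C}$ with $\operatorname{Im}\lambda\ge 0$ and $r>0$, let $$R_X(\lambda,r)=C_X(\lambda)\cosh^{-\sigma+i\lambda}(r)\,{}_2F_1\!\left(\tfrac{\sigma-i\lambda}{2},\tfrac{\sigma-i\lambda}{2}-\beta;1-i\lambda;\cosh^{-2}(r)\right),\quad C_X(\lambda)=\pi^{-(\dim N_X+1)/2}\frac{\Gamma\big(\tfrac{\sigma-i\lambda}{2}\big)\Gamma\big(\tfrac{\sigma-i\lambda}{2}-\beta\big)}{4\Gamma(1-i\lambda)}$$ be the resolvent kernel of the Laplace–Beltrami operator $L_X$. Let $Y$ be the real hyperbolic space of dimension $n=\dim N_X+\dim Z_X+1$ (an odd number) and let $R_Y(\lambda,\rho)$ be its resolvent kernel, $$R_Y(\lambda,\rho)=C_{n,\lambda}\,(\cosh(\rho/2))^{2i\lambda-(n-1)}\,{}_2F_1\!\left(\tfrac{n-1}{2}-i\lambda,\tfrac12-i\lambda;1-2i\lambda;\cosh^{-2}(\rho/2)\right),\quad C_{n,\lambda}=2^{-(n-2i\lambda)}\pi^{-(n-1)/2}\frac{\Gamma(\frac{n-1}{2}-i\lambda)}{\Gamma(1-i\lambda)}.$$ Then $$R_X(\lambda,r)=\int_r^\infty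 W_X(r,\rho)\,R_Y(\lambda,\rho)\sinh(\rho)\,d\rho,$$ where the kernel $W_X(r,\rho)$, independent of $\lambda$, is $$W_X(r,\rho)=\frac{2\pi^{\dim Z_X/2}}{\Gamma(\dim Z_X/2)}\cosh^{1-\dim Z_X}(r)\left(\cosh^2\rho-\cosh^2 r\right)^{(\dim Z_X-2)/2}.$$
   Context: $X=NA$ is a solvable Lie group with left-invariant Riemannian metric (a harmonic $NA$ group), $N$ being nilpotent (of Heisenberg type) and $A\cong\mathbb{R}$; the radial part of its Laplace–Beltrami operator in geodesic polar coordinates is $\frac{d^2}{dr^2}+\{\dim N_X\coth r+\dim Z_X\tanh r\}\frac{d}{dr}$, and the resolvent kernel is the solution singular at $r=0$ of $(\mathrm{rad}(L_X)+\sigma^2+\lambda^2)R=0$, given explicitly by the formula in the claim. ${}_2F_1(a,b;c;z)=\frac{\Gamma(c)}{\Gamma(a)\Gamma(b)}\sum_{k\ge0}\frac{\Gamma(a+k)\Gamma(b+k)}{k!\,\Gamma(c+k)}z^k$ is the Gauss hypergeometric function. *)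

theory Defs
  imports "HOL-Analysis.Analysis"
begin

text \<open>Gauss hypergeometric series (Pochhammer form, equal to the Gamma-ratio
form of the paper wherever the latter is defined).\<close>
definition hyp2F1 :: "complex \<Rightarrow> complex \<Rightarrow> complex \<Rightarrow> complex \<Rightarrow> complex" where
  "hyp2F1 a b c z =
     (\<Sum>j. pochhammer a j * pochhammer b j / (pochhammer c j * of_nat (fact j)) * z ^ j)"

definition matmul :: "nat \<Rightarrow> (nat \<Rightarrow> nat \<Rightarrow> real) \<Rightarrow> (nat \<Rightarrow> nat \<Rightarrow> real) \<Rightarrow> nat \<Rightarrow> nat \<Rightarrow> real" where
  "matmul v A B = (\<lambda>a b. \<Sum>c<v. A a c * B c b)"

text \<open>Dimensions (dim N, dim Z) = (m, k) of a Heisenberg-type group with nontrivial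
center: N = V + Z, dim V = m - k > 0, dim Z = k \<ge> 1, and there are skew-symmetric
J_1..J_k on V (orthonormal basis coordinates) with J_i J_j + J_j J_i = -2 delta_ij I,
i.e. J_Z = sum z_i J_i satisfies J_Z^2 = -|Z|^2 I.  k \<ge> 1 excludes the real
hyperbolic spaces (abelian N).\<close>
definition htype_dims :: "nat \<Rightarrow> nat \<Rightarrow> bool" where
  "htype_dims m k \<longleftrightarrow> 1 \<le> k \<and> k < m \<and>
     (\<exists>J :: nat \<Rightarrow> nat \<Rightarrow> nat \<Rightarrow> real.
        (\<forall>i<k. \<forall>a<m-k. \<forall>b<m-k. J i b a = - J i a b) \<and>
        (\<forall>i<k. \<forall>j<k. \<forall>a<m-k. \<forall>b<m-k.
           matmul (m-k) (J i) (J j) a b + matmul (m-k) (J j) (J i) a b =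
             (if i = j \<and> a = b then -2 else 0)))"

definition sigmaX :: "nat \<Rightarrow> nat \<Rightarrow> real" where
  "sigmaX m k = (real m + real k) / 2"

definition betaX :: "nat \<Rightarrow> real" where
  "betaX k = (real k - 1) / 2"

definition C_X :: "nat \<Rightarrow> nat \<Rightarrow> complex \<Rightarrow> complex" where
  "C_X m k lam =
     of_real (pi powr (- (real m + 1) / 2)) *
     Gamma ((of_real (sigmaX m k) - \<i> * lam) / 2) *
     Gamma ((of_real (sigmaX m k) - \<i> * lam) / 2 - of_real (betaX k)) /
     (4 * Gamma (1 - \<i> * lam))"

definition R_X :: "nat \<Rightarrow> nat \<Rightarrow> complex \<Rightarrow> real \<Rightarrow> complex" where
  "R_X m k lam r =
     C_X m k lam * (of_real (cosh r)) powr (- of_real (sigmaX m k) + \<i> * lam) *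
     hyp2F1 ((of_real (sigmaX m k) - \<i> * lam) / 2)
            ((of_real (sigmaX m k) - \<i> * lam) / 2 - of_real (betaX k))
            (1 - \<i> * lam) (of_real (1 / (cosh r)\<^sup>2))"

definition C_Y :: "nat \<Rightarrow> complex \<Rightarrow> complex" where
  "C_Y n lam =
     2 powr (- (of_nat n - 2 * \<i> * lam)) * of_real (pi powr (- (real n - 1) / 2)) *
     Gamma ((of_nat n - 1) / 2 - \<i> * lam) / Gamma (1 - \<i> * lam)"

definition R_Y :: "nat \<Rightarrow> complex \<Rightarrow> real \<Rightarrow> complex" where
  "R_Y n lam \<rho> =
     C_Y n lam * (of_real (cosh (\<rho> / 2))) powr (2 * \<i> * lam - (of_nat n - 1)) *
     hyp2F1 ((of_nat n - 1) / 2 - \<i> * lam) (1 / 2 - \<i> * lam) (1 - 2 * \<i> * lam)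
            (of_real (1 / (cosh (\<rho> / 2))\<^sup>2))"

definition W_X :: "nat \<Rightarrow> real \<Rightarrow> real \<Rightarrow> real" where
  "W_X k r \<rho> =
     2 * pi powr (real k / 2) / Gamma (real k / 2) * cosh r powr (1 - real k) *
     ((cosh \<rho>)\<^sup>2 - (cosh r)\<^sup>2) powr ((real k - 2) / 2)"

end

theory Submission
  imports Defs
begin

text \<open>
With \<open>w = 1 / cosh \<rho>\<close> one has \<open>1 / cosh\<^sup>2 (\<rho>/2) = 2w / (1 + w)\<close>, so the quadratic transformation
of \<open>F(a, b; 2b; 2w / (1 + w))\<close> and Legendre duplication turn \<open>R\<^sub>Y\<close> into a constant times
\<open>cosh \<rho> powr (-2\<alpha>) F(\<alpha>, \<alpha> + 1/2; 1 - i\<lambda>; 1 / cosh\<^sup>2 \<rho>)\<close> with \<open>\<alpha> = (\<sigma> - i\<lambda>) / 2\<close>.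
The substitution \<open>t = cosh\<^sup>2 r / cosh\<^sup>2 \<rho>\<close> then makes the integral an Euler integral
with weight \<open>t powr (\<alpha> - \<beta> - 1) (1 - t) powr (dim Z / 2 - 1)\<close>, and as
\<open>(\<alpha> - \<beta>) + dim Z / 2 = \<alpha> + 1/2\<close>, termwise integration replaces the parameter
\<open>\<alpha> + 1/2\<close> by \<open>\<alpha> - \<beta>\<close>.

The quadratic transformation itself comes from the Euler integral of \<open>F(a, b; 2b; z)\<close>:
since \<open>1 + w(1 - 2t) = (1 + w)(1 - zt)\<close> for \<open>z = 2w / (1 + w)\<close>, it can be expanded
in powers of \<open>w(1 - 2t)\<close>, whose odd moments vanish by symmetry.
\<close>

section \<open>The Beta integral with complex parameters\<close>

lemma Re_pos_notin_nonpos_Ints: "Re z > 0 \<Longrightarrow> z \<notin> \<int>\<^sub>\<le>\<^sub>0"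
  by (auto elim!: nonpos_Ints_cases)

definition beta_kernel :: "complex \<Rightarrow> complex \<Rightarrow> real \<Rightarrow> complex" where
  "beta_kernel a b t = of_real t powr (a - 1) * of_real (1 - t) powr (b - 1)"

lemma norm_beta_kernel:
  assumes "0 < t" "t < 1"
  shows "norm (beta_kernel a b t) = t powr (Re a - 1) * (1 - t) powr (Re b - 1)"
  using assms by (simp add: beta_kernel_def norm_mult norm_powr_real_powr flip: of_real_diff)

lemma beta_kernel_plus1_left: "0 < t \<Longrightarrow> beta_kernel (a + 1) b t = of_real t * beta_kernel a b t"
  by (simp add: beta_kernel_def powr_diff)

lemma beta_kernel_plus1_right:
  "t < 1 \<Longrightarrow> beta_kernel a (b + 1) t = of_real (1 - t) * beta_kernel a b t"
  by (simp add: beta_kernel_def powr_diff del: of_real_diff)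

lemma integrable_norm_beta_kernel:
  assumes "Re a > 0" "Re b > 0"
  shows "(\<lambda>t. norm (beta_kernel a b t)) integrable_on {0<..<1}"
proof -
  have "(\<lambda>t. t powr (Re a - 1) * (1 - t) powr (Re b - 1)) integrable_on {0<..<1::real}"
    using has_integral_Beta_real[OF assms] unfolding has_integral_Icc_iff_Ioo by blast
  thus ?thesis
    by (rule integrable_eq) (simp add: norm_beta_kernel)
qed

lemma continuous_on_beta_kernel: "continuous_on {0<..<1} (beta_kernel a b)"
  unfolding beta_kernel_def
  by (intro continuous_intros) (auto simp: complex_nonpos_Reals_iff)

lemma absolutely_integrable_beta_kernel:
  assumes "Re a > 0" "Re b > 0"
  shows "beta_kernel a b absolutely_integrable_on {0<..<1}"
  by (rule measurable_bounded_by_integrable_imp_absolutely_integrable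
        [OF _ _ integrable_norm_beta_kernel[OF assms]])
     (auto intro!: continuous_imp_measurable_on_sets_lebesgue continuous_on_beta_kernel)

text \<open>The Gamma integrand is extended by zero to the whole line, so that convolution and
  translation can be carried out over all of \<open>lborel\<close> with no domain to track.\<close>

definition gamma_kernel :: "complex \<Rightarrow> real \<Rightarrow> complex" where
  "gamma_kernel a s = indicator {0<..} s *\<^sub>R (of_real s powr (a - 1) / of_real (exp s))"

lemma borel_measurable_gamma_kernel [measurable]: "gamma_kernel a \<in> borel_measurable borel"
  unfolding gamma_kernel_def
  by (intro borel_measurable_continuous_on_indicator continuous_intros)
     (auto simp: complex_nonpos_Reals_iff)

text \<open>Fubini's theorem is applied on \<open>lborel \<Otimes>\<^sub>M lborel\<close>, so the
  Gamma integral is moved from the completed measure to \<open>lborel\<close>; Borel measurability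
  of the kernel makes the two integrals agree.\<close>

lemma has_bochner_integral_gamma_kernel:
  assumes "Re a > 0"
  shows "has_bochner_integral lborel (gamma_kernel a) (Gamma a)"
proof -
  have 1: "(\<lambda>t. of_real t powr (a - 1) / of_real (exp t)) absolutely_integrable_on {0<..}"
    using absolutely_integrable_Gamma_integral'[OF assms] .
  hence 2: "integrable lebesgue (gamma_kernel a)"
    unfolding set_integrable_def gamma_kernel_def .
  have "integral\<^sup>L lebesgue (gamma_kernel a) = Gamma a"
    using set_lebesgue_integral_eq_integral(2)[OF 1] integral_unique[OF Gamma_integral_complex'[OF assms]]
    unfolding set_lebesgue_integral_def gamma_kernel_def by simp
  thus ?thesis using 2
    by (simp add: has_bochner_integral_iff integrable_completion integral_completion)
qed

text \<open>For v > 0 the substitution s = v t pulls out the power of v and exp (-v), leaving a Beta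
  integral over 0 < t < 1. For v \<le> 0 the supports of the two factors do not meet.\<close>

lemma gamma_kernel_convolution:
  assumes "Re a > 0" "Re b > 0"
  shows "(\<integral>s. gamma_kernel a s * gamma_kernel b (v - s) \<partial>lborel) =
           integral {0<..<1} (beta_kernel a b) * gamma_kernel (a + b) v"
proof (cases "v > 0")
  case False
  hence "(\<lambda>s. gamma_kernel a s * gamma_kernel b (v - s)) = (\<lambda>s. 0)"
    by (auto simp: gamma_kernel_def indicator_def)
  thus ?thesis using False by (simp only:) (simp add: gamma_kernel_def)
next
  case True
  \<comment> \<open>The two kernels contribute v to the power a + b - 2, written here as a power a +
    b - 1 divided by v; the Jacobian of s = v t cancels that division. The form
    \<open>0 + v * t\<close> matches the affine substitution rule.\<close>
  have *: "gamma_kernel a (0 + v * t) * gamma_kernel b (v - (0 + v * t)) =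
          (of_real v powr (a + b - 1) / of_real v / of_real (exp v)) *
            (indicator {0<..<1} t *\<^sub>R beta_kernel a b t)" for t
  proof (cases "0 < t \<and> t < 1")
    case t: True
    have 1: "of_real (v * t) powr (a - 1) = of_real v powr (a - 1) * (of_real t powr (a - 1) :: complex)"
      using t True by (simp add: powr_times_real)
    have "v - v * t = v * (1 - t)" by (simp add: algebra_simps)
    hence 2: "of_real (v - v * t) powr (b - 1) =
        of_real v powr (b - 1) * (of_real (1 - t) powr (b - 1) :: complex)"
      using t True by (simp add: powr_times_real del: of_real_diff)
    have 3: "v * t > 0" "v - v * t > 0"
      using t True by auto
    have 4: "exp v = exp (v * t) * exp (v - v * t)"
      by (simp flip: exp_add)
    have 5: "a + b - 1 = (a - 1) + (b - 1) + 1" by simp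
    show ?thesis
      unfolding gamma_kernel_def beta_kernel_def 4 5 powr_add
      using 1 2 3 t True by simp
  next
    case False
    hence "gamma_kernel a (v * t) = 0 \<or> gamma_kernel b (v - v * t) = 0" using True
      by (auto simp: gamma_kernel_def indicator_def zero_less_mult_iff)
    with False show ?thesis by auto
  qed
  have m: "(\<lambda>t. indicator {0<..<1} t *\<^sub>R beta_kernel a b t) \<in> borel_measurable borel"
    by (intro borel_measurable_continuous_on_indicator continuous_on_beta_kernel) auto
  have "(\<integral>s. gamma_kernel a s * gamma_kernel b (v - s) \<partial>lborel) =
     \<bar>v\<bar> *\<^sub>R (\<integral>t. gamma_kernel a (0 + v * t) * gamma_kernel b (v - (0 + v * t)) \<partial>lborel)"
    using True by (intro lborel_integral_real_affine) auto
  also have "\<dots> = of_real v powr (a + b - 1) / of_real (exp v) *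
       (\<integral>t. indicator {0<..<1} t *\<^sub>R beta_kernel a b t \<partial>lborel)"
    unfolding * using True by (simp add: scaleR_conv_of_real)
  also have "(\<integral>t. indicator {0<..<1} t *\<^sub>R beta_kernel a b t \<partial>lborel) =
     integral {0<..<1} (beta_kernel a b)"
    using set_lebesgue_integral_eq_integral(2)[OF absolutely_integrable_beta_kernel[OF assms]] m
    unfolding set_lebesgue_integral_def by (simp add: integral_completion)
  finally show ?thesis using True by (simp add: gamma_kernel_def)
qed

text \<open>The convolution identity is integrated over v. Fubini turns one side into Gamma a *
  Gamma b, the other is the Beta integral times Gamma (a + b), which is nonzero.\<close>

theorem has_integral_Beta_complex:
  assumes "Re a > 0" "Re b > 0"
  shows "(beta_kernel a b has_integral Beta a b) {0<..<1}"
proof -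
  let ?g = "\<lambda>s v. gamma_kernel a s * gamma_kernel b (v - s)"
  have A: "integrable lborel (gamma_kernel a)" "integral\<^sup>L lborel (gamma_kernel a) = Gamma a"
    and B: "integrable lborel (gamma_kernel b)" "integral\<^sup>L lborel (gamma_kernel b) = Gamma b"
    and AB: "integral\<^sup>L lborel (gamma_kernel (a + b)) = Gamma (a + b)"
    using has_bochner_integral_gamma_kernel[of a] has_bochner_integral_gamma_kernel[of b]
      has_bochner_integral_gamma_kernel[of "a + b"] assms
    by (auto simp: has_bochner_integral_iff)
  have shift: "integrable lborel (\<lambda>v. gamma_kernel b (v - s))" for s
    using lborel_integrable_real_affine[OF B(1), of 1 "-s"] by simp
  have shift_int: "(\<integral>v. h (v - s) \<partial>lborel) = integral\<^sup>L lborel h"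
    for s :: real and h :: "real \<Rightarrow> 'z :: {banach,second_countable_topology}"
    using lborel_integral_real_affine[of 1 h "-s"] by simp
  have "integrable (lborel \<Otimes>\<^sub>M lborel) (\<lambda>(s, v). ?g s v)"
  proof (rule lborel_pair.Fubini_integrable)
    \<comment> \<open>By translation invariance the inner integral of the norm is the norm of the
      first kernel times a constant independent of s.\<close>
    have "(\<lambda>s. \<integral>v. norm (?g s v) \<partial>lborel) =
        (\<lambda>s. norm (gamma_kernel a s) * (\<integral>v. norm (gamma_kernel b v) \<partial>lborel))"
      using shift_int[of "\<lambda>v. norm (gamma_kernel b v)"] by (simp add: norm_mult)
    thus "integrable lborel (\<lambda>s. \<integral>v. norm (case (s, v) of (s, v) \<Rightarrow> ?g s v) \<partial>lborel)"
      using A by simp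
  qed (use shift in auto)
  from lborel_pair.Fubini_integral[OF this]
  have "(\<integral>v. (\<integral>s. ?g s v \<partial>lborel) \<partial>lborel) = (\<integral>s. (\<integral>v. ?g s v \<partial>lborel) \<partial>lborel)" .
  also have "\<dots> = Gamma a * Gamma b"
    using shift_int[of "gamma_kernel b"] A B by simp
  finally have "integral {0<..<1} (beta_kernel a b) * Gamma (a + b) = Gamma a * Gamma b"
    using AB by (simp add: gamma_kernel_convolution assms)
  moreover have "Gamma (a + b) \<noteq> 0"
    using assms by (simp add: Gamma_eq_zero_iff Re_pos_notin_nonpos_Ints)
  ultimately have "integral {0<..<1} (beta_kernel a b) = Beta a b"
    by (simp add: Beta_def field_simps)
  thus ?thesis
    using absolutely_integrable_beta_kernel[OF assms] set_lebesgue_integral_eq_integral(1)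
    by (metis has_integral_integral)
qed

section \<open>Termwise integration against the Beta kernel\<close>

text \<open>Dominated convergence: since |\<phi>| \<le> 1, every partial sum is bounded by the
  constant sum of the norms of \<open>e n\<close> times the norm of the kernel. Both \<phi> t = t
  and \<phi> t = 1 - 2t occur later, so \<phi> and its moments \<open>M\<close> are left
  general.\<close>

lemma absolutely_integrable_beta_series:
  fixes e :: "nat \<Rightarrow> complex"
  assumes ab: "Re a > 0" "Re b > 0" and e: "summable (\<lambda>n. norm (e n))"
    and \<phi>: "\<And>t. 0 < t \<Longrightarrow> t < 1 \<Longrightarrow> \<bar>\<phi> t\<bar> \<le> 1"
    and M: "\<And>n. ((\<lambda>t. beta_kernel a b t * of_real (\<phi> t) ^ n) has_integral M n) {0<..<1}"
  defines "f \<equiv> \<lambda>t. beta_kernel a b t * (\<Sum>n. e n * of_real (\<phi> t) ^ n)"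
  shows "f absolutely_integrable_on {0<..<1}"
    and "(\<lambda>n. e n * M n) sums integral {0<..<1} f"
proof -
  define C where "C = (\<Sum>n. norm (e n))"
  define S where "S = (\<lambda>k t. beta_kernel a b t * (\<Sum>n<k. e n * of_real (\<phi> t) ^ n))"
  have term_le: "norm (e n * of_real (\<phi> t) ^ n) \<le> norm (e n)" if "0 < t" "t < 1" for n t
    using \<phi>[OF that] by (simp add: norm_mult norm_power mult_left_le power_le_one)
  have term_summable: "summable (\<lambda>n. norm (e n * of_real (\<phi> t) ^ n))" if "0 < t" "t < 1" for t
    by (rule summable_comparison_test'[OF e, of 0]) (use term_le[OF that] in auto)
  have partial_le: "norm (\<Sum>n<k. e n * of_real (\<phi> t) ^ n) \<le> C" if "0 < t" "t < 1" for t k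
  proof -
    have "norm (\<Sum>n<k. e n * of_real (\<phi> t) ^ n) \<le> (\<Sum>n<k. norm (e n))"
      by (rule sum_norm_le) (use term_le[OF that] in auto)
    also have "\<dots> \<le> C" unfolding C_def by (rule sum_le_suminf[OF e]) auto
    finally show ?thesis .
  qed
  have S_int: "(S k has_integral (\<Sum>n<k. e n * M n)) {0<..<1}" for k
  proof -
    have "((\<lambda>t. \<Sum>n<k. e n * (beta_kernel a b t * of_real (\<phi> t) ^ n)) has_integral
            (\<Sum>n<k. e n * M n)) {0<..<1}"
      by (intro has_integral_sum has_integral_mult_right M) auto
    thus ?thesis by (simp add: S_def sum_distrib_left mult_ac)
  qed
  let ?h = "\<lambda>t. C * norm (beta_kernel a b t)"
  have h: "?h integrable_on {0<..<1}"
    using integrable_norm_beta_kernel[OF ab] by (intro integrable_on_mult_right)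
  have S_le: "norm (S k t) \<le> ?h t" if "t \<in> {0<..<1}" for k t
    using partial_le[of t k] that
    by (simp add: S_def norm_mult mult.commute[of C] mult_left_mono)
  have lim: "(\<lambda>k. S k t) \<longlonglongrightarrow> f t" if "t \<in> {0<..<1}" for t
    using summable_LIMSEQ[OF summable_norm_cancel[OF term_summable[of t]]] that
    unfolding S_def f_def by (intro tendsto_mult_left) auto
  have f_le: "norm (f t) \<le> ?h t" if "t \<in> {0<..<1}" for t
    by (rule tendsto_upperbound[OF tendsto_norm[OF lim[OF that]]]) (use S_le[OF that] in auto)
  have "S k integrable_on {0<..<1}" for k using S_int by blast
  note dc = dominated_convergence[OF this h S_le lim]
  show "f absolutely_integrable_on {0<..<1}"
    using f_le dc(1) h by (rule absolutely_integrable_integrable_bound)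
  show "(\<lambda>n. e n * M n) sums integral {0<..<1} f"
    using dc(2) unfolding sums_def integral_unique[OF S_int] .
qed

text \<open>The factor t^n only shifts \<open>a\<close> to a + n in the kernel, and the quotients of
  shifted Gamma values are Pochhammer symbols.\<close>

lemma has_integral_beta_kernel_power:
  assumes "Re a > 0" "Re b > 0"
  shows "((\<lambda>t. beta_kernel a b t * of_real t ^ n) has_integral
           Beta a b * pochhammer a n / pochhammer (a + b) n) {0<..<1}"
proof -
  have *: "beta_kernel (a + of_nat n) b t = beta_kernel a b t * of_real t ^ n" if "0 < t" for t
    using that by (simp add: beta_kernel_def powr_add powr_diff)
  have nz: "a \<notin> \<int>\<^sub>\<le>\<^sub>0" "a + b \<notin> \<int>\<^sub>\<le>\<^sub>0" "a + b + of_nat n \<notin> \<int>\<^sub>\<le>\<^sub>0"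
    using assms by (auto intro!: Re_pos_notin_nonpos_Ints simp: add_pos_nonneg)
  have "Beta (a + of_nat n) b = Beta a b * pochhammer a n / pochhammer (a + b) n"
    using nz by (simp add: Beta_def pochhammer_Gamma Gamma_eq_zero_iff field_simps)
  moreover have "(beta_kernel (a + of_nat n) b has_integral Beta (a + of_nat n) b) {0<..<1}"
    using assms by (intro has_integral_Beta_complex) (auto simp: add_pos_nonneg)
  ultimately show ?thesis
    using * by (metis (no_types, lifting) greaterThanLessThan_iff has_integral_cong)
qed

section \<open>Moments of 1 - 2t against the symmetric Beta kernel\<close>

definition beta_moment :: "complex \<Rightarrow> nat \<Rightarrow> complex" where
  "beta_moment b n = (if even n
     then Beta b b * pochhammer (1/2) (n div 2) / pochhammer (b + 1/2) (n div 2) else 0)"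

text \<open>Reflects \<open>(1 - 2t)\<^sup>2 = 1 - 4t(1 - t)\<close>, where \<open>t(1 - t)\<close> raises both kernel parameters by one.\<close>

lemma beta_moment_Suc_Suc:
  assumes "Re b > 0"
  shows "beta_moment b (Suc (Suc n)) = beta_moment b n - 4 * beta_moment (b + 1) n"
proof (cases "even n")
  case True
  then obtain p where n: "n = 2 * p" by blast
  have nz: "b \<noteq> 0" "b + 1/2 + of_nat j \<noteq> 0" for j
    using assms by (auto simp: complex_eq_iff)
  have "b \<notin> \<int>\<^sub>\<le>\<^sub>0" "2 * b \<notin> \<int>\<^sub>\<le>\<^sub>0" "2 * b + 1 \<notin> \<int>\<^sub>\<le>\<^sub>0"
    using assms by (auto intro!: Re_pos_notin_nonpos_Ints)
  have G2: "Gamma (2 * b + 1 + 1) = (2 * b + 1) * (2 * b * Gamma (2 * b))"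
    using Gamma_plus1[OF \<open>2 * b \<notin> _\<close>] Gamma_plus1[OF \<open>2 * b + 1 \<notin> _\<close>] by simp
  \<comment> \<open>If H or d is 0, both sides are 0 by the convention for division by zero;
    otherwise one factor b cancels.\<close>
  have cancel: "b * G * (b * G) / (d * (2 * b * H)) = G * G / H * (b / (2 * d))" for d G H :: complex
    using nz(1) by (cases "H = 0"; cases "d = 0") (simp_all add: field_simps)
  have "(b + 1) + (b + 1) = 2 * b + 1 + 1" by simp
  hence "Beta (b + 1) (b + 1) = b * Gamma b * (b * Gamma b) / ((2 * b + 1) * (2 * b * Gamma (2 * b)))"
    unfolding Beta_def by (simp only: G2 Gamma_plus1[OF \<open>b \<notin> _\<close>])
  also have "\<dots> = Beta b b * (b / (2 * (2 * b + 1)))"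
    unfolding cancel by (simp only: Beta_def mult_2)
  finally have Beta: "Beta (b + 1) (b + 1) = Beta b b * (b / (2 * (2 * b + 1)))" .
  \<comment> \<open>Both sides are the Pochhammer symbol of b + 1/2 of length p + 1, with its first
    or its last factor split off.\<close>
  have shift: "(b + 1/2) * pochhammer (b + 1 + 1/2) p = pochhammer (b + 1/2) p * (b + 1/2 + of_nat p)"
    using pochhammer_rec[of "b + 1/2" p] pochhammer_Suc[of "b + 1/2" p] by (simp add: add_ac)
  have poch1: "pochhammer (b + 1 + 1/2) p = pochhammer (b + 1/2) p * (b + 1/2 + of_nat p) / (b + 1/2)"
    by (rule eq_divide_imp) (use shift nz(2)[of 0] in \<open>simp_all add: mult.commute\<close>)
  have m1: "4 * beta_moment (b + 1) n =
      Beta b b * pochhammer (1/2) p * (b / (pochhammer (b + 1/2) p * (b + 1/2 + of_nat p)))"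
  proof -
    have h: "b + 1/2 \<noteq> 0" "2 * (2 * b + 1) = 4 * (b + 1/2)" using nz(2)[of 0] by auto
    have "4 * (B * (b / (4 * h)) * P / (Q * r / h)) = B * P * (b / (Q * r))"
      if "h \<noteq> 0" for B P Q r h :: complex using that by simp
    note this[OF h(1)]
    moreover have "beta_moment (b + 1) n =
        Beta (b + 1) (b + 1) * pochhammer (1/2) p / pochhammer (b + 1 + 1/2) p"
      by (simp add: beta_moment_def n)
    ultimately show ?thesis by (simp only: Beta h(2) poch1)
  qed
  \<comment> \<open>Expanding by b + 1/2 + p gives the denominator of \<open>m1\<close>. The
    difference of the numerators is 1/2 + p, the next factor of the Pochhammer symbol of
    1/2.\<close>
  have m0: "beta_moment b n = Beta b b * pochhammer (1/2) p *
      ((b + 1/2 + of_nat p) / (pochhammer (b + 1/2) p * (b + 1/2 + of_nat p)))"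
    using nz(2)[of p] by (simp add: beta_moment_def n)
  have "beta_moment b (Suc (Suc n)) = Beta b b * pochhammer (1/2) p *
      ((b + 1/2 + of_nat p - b) / (pochhammer (b + 1/2) p * (b + 1/2 + of_nat p)))"
    by (simp add: beta_moment_def n pochhammer_Suc)
  thus ?thesis
    unfolding m0 m1 by (simp only: diff_divide_distrib right_diff_distrib)
qed (simp add: beta_moment_def)

text \<open>Induction in steps of two, with \<open>b\<close> generalised because the recursion
  refers to b + 1. For n = 1, write 1 - 2t = (1 - t) - t; the two resulting Beta integrals cancel by
  symmetry.\<close>

lemma has_integral_beta_moment:
  assumes "Re b > 0"
  shows "((\<lambda>t. beta_kernel b b t * of_real (1 - 2 * t) ^ n) has_integral beta_moment b n) {0<..<1}"
  using assms
proof (induction n arbitrary: b rule: induct_nat_012)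
  case 0
  thus ?case using has_integral_Beta_complex[of b b] by (simp add: beta_moment_def)
next
  case 1
  have "((\<lambda>t. beta_kernel b (b + 1) t - beta_kernel (b + 1) b t) has_integral
          Beta b (b + 1) - Beta (b + 1) b) {0<..<1}"
    using 1 by (intro has_integral_diff has_integral_Beta_complex) auto
  hence "((\<lambda>t. beta_kernel b (b + 1) t - beta_kernel (b + 1) b t) has_integral 0) {0<..<1}"
    by (simp add: Beta_commute)
  hence "((\<lambda>t. beta_kernel b b t * of_real (1 - 2 * t) ^ Suc 0) has_integral 0) {0<..<1}"
    by (rule has_integral_eq[rotated])
       (auto simp: beta_kernel_plus1_left beta_kernel_plus1_right ring_distribs)
  thus ?case by (simp add: beta_moment_def)
next
  case (ge2 n)
  have "((\<lambda>t. beta_kernel b b t * of_real (1 - 2 * t) ^ n -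
             4 * (beta_kernel (b + 1) (b + 1) t * of_real (1 - 2 * t) ^ n)) has_integral
          beta_moment b n - 4 * beta_moment (b + 1) n) {0<..<1}"
    using ge2.prems by (intro has_integral_diff has_integral_mult_right ge2.IH(1)) auto
  moreover have K: "beta_kernel (b + 1) (b + 1) t = of_real (t * (1 - t)) * beta_kernel b b t"
    if "t \<in> {0<..<1}" for t
    using that by (simp add: beta_kernel_plus1_left beta_kernel_plus1_right)
  ultimately show ?case unfolding beta_moment_Suc_Suc[OF ge2.prems]
    by (elim has_integral_eq[rotated]) (simp only: K, simp add: algebra_simps)
qed

section \<open>Absolute convergence of the Gauss series\<close>

lemma summable_norm_hyp2F1:
  assumes c: "c \<notin> \<int>\<^sub>\<le>\<^sub>0" and z: "norm z < 1"
  shows "summable (\<lambda>n. norm (pochhammer a n * pochhammer b n /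
           (pochhammer c n * of_nat (fact n)) * z ^ n :: complex))"
proof -
  have lim1: "(\<lambda>n. (a + of_nat n) / (c + of_nat n)) \<longlonglongrightarrow> 1" for a c :: complex
  proof -
    have inf: "filterlim (\<lambda>n. c + of_nat n) at_infinity sequentially"
      using tendsto_add_filterlim_at_infinity[OF tendsto_const[of c] tendsto_of_nat] .
    have "(\<lambda>n. 1 + (a - c) / (c + of_nat n)) \<longlonglongrightarrow> 1 + 0"
      by (intro tendsto_add tendsto_const tendsto_divide_0[OF tendsto_const inf])
    moreover have "eventually (\<lambda>n. c + of_nat n \<noteq> 0) sequentially"
      using filterlim_at_infinity_imp_eventually_ne[OF inf, of 0] .
    hence "eventually (\<lambda>n. 1 + (a - c) / (c + of_nat n) = (a + of_nat n) / (c + of_nat n)) sequentially"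
      by eventually_elim (simp add: field_simps)
    ultimately show ?thesis by (simp add: tendsto_cong)
  qed
  define f where "f = (\<lambda>n. pochhammer a n * pochhammer b n / (pochhammer c n * of_nat (fact n)) * z ^ n)"
  \<comment> \<open>The ratio of consecutive terms, used in the product form
    \<open>f (Suc n) = q n * f n\<close> so that vanishing terms do no harm. The factorial supplies
    1 + n, so \<open>lim1\<close> applies to both fractions.\<close>
  define q where "q = (\<lambda>n. (a + of_nat n) / (c + of_nat n) * ((b + of_nat n) / (1 + of_nat n)) * z)"
  have "(\<lambda>n. norm (q n)) \<longlonglongrightarrow> norm (1 * 1 * z)"
    unfolding q_def by (intro tendsto_norm tendsto_mult lim1 tendsto_const)
  moreover obtain \<rho> where \<rho>: "norm z < \<rho>" "\<rho> < 1" using z dense by blast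
  ultimately have "eventually (\<lambda>n. norm (q n) < \<rho>) sequentially"
    by (intro order_tendstoD) auto
  then obtain N where N: "\<And>n. n \<ge> N \<Longrightarrow> norm (q n) < \<rho>"
    unfolding eventually_sequentially by blast
  have step: "f (Suc n) = q n * f n" for n
    by (simp add: f_def q_def pochhammer_Suc field_simps)
  have "summable (\<lambda>n. norm (f n))"
  proof (rule summable_ratio_test[OF \<rho>(2)])
    fix n assume "n \<ge> N"
    thus "norm (norm (f (Suc n))) \<le> \<rho> * norm (norm (f n))"
      using N[of n] by (simp add: step norm_mult mult_right_mono)
  qed
  thus ?thesis by (simp add: f_def)
qed

section \<open>The quadratic transformation\<close>

lemma hyp2F1_sums:
  assumes "c \<notin> \<int>\<^sub>\<le>\<^sub>0" "norm z < 1"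
  shows "(\<lambda>n. pochhammer a n * pochhammer b n / (pochhammer c n * of_nat (fact n)) * z ^ n)
           sums hyp2F1 a b c z"
  unfolding hyp2F1_def
  by (rule summable_sums[OF summable_norm_cancel[OF summable_norm_hyp2F1[OF assms]]])

text \<open>The binomial series is the Gauss series with b = c = 1.\<close>

lemma summable_norm_binomial_series:
  fixes a z :: complex
  assumes "norm z < 1"
  shows "summable (\<lambda>n. norm (pochhammer a n / fact n * z ^ n))"
proof -
  have "(1 :: complex) \<notin> \<int>\<^sub>\<le>\<^sub>0" by (rule Re_pos_notin_nonpos_Ints) simp
  moreover have "pochhammer (1 :: complex) n = fact n" for n by (rule pochhammer_fact[symmetric])
  ultimately show ?thesis using summable_norm_hyp2F1[of 1 z a 1] assms by simp
qed

lemma binomial_series_sums: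
  fixes a z :: complex
  assumes "norm z < 1"
  shows "(\<lambda>n. pochhammer a n / fact n * z ^ n) sums (1 - z) powr (-a)"
proof -
  have "(- a gchoose n) * (- z) ^ n = pochhammer a n / fact n * z ^ n" for n
  proof -
    have "(-1) ^ n * (- z) ^ n = z ^ n"
      by (metis mult_minus1 minus_minus power_mult_distrib)
    thus ?thesis by (simp add: gbinomial_pochhammer)
  qed
  thus ?thesis using gen_binomial_complex[of "-z" "-a"] assms by simp
qed

text \<open>The third parameter 2b makes both exponents of the Euler kernel equal, hence the kernel
  symmetric under t to 1 - t. The integral \<open>f1\<close> is expanded in powers of t,
  \<open>f2\<close> in powers of 1 - 2t, and the integrands differ by the constant factor (1 +
  w)^a.\<close>

theorem hyp2F1_quadratic:
  fixes w :: real
  assumes b: "Re b > 0" and w: "0 \<le> w" "w < 1"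
  shows "hyp2F1 a b (2 * b) (of_real (2 * w / (1 + w))) =
           of_real (1 + w) powr a * hyp2F1 (a / 2) (a / 2 + 1/2) (b + 1/2) (of_real (w\<^sup>2))"
proof -
  define z where "z = 2 * w / (1 + w)"
  have z: "0 \<le> z" "z < 1" using w by (auto simp: z_def field_simps)
  have nz: "2 * b \<notin> \<int>\<^sub>\<le>\<^sub>0" "b + 1/2 \<notin> \<int>\<^sub>\<le>\<^sub>0" "b \<notin> \<int>\<^sub>\<le>\<^sub>0"
    using b by (auto intro!: Re_pos_notin_nonpos_Ints)
  define f1 where "f1 = (\<lambda>t. beta_kernel b b t *
    (\<Sum>n. pochhammer a n / fact n * of_real z ^ n * of_real t ^ n))"
  define f2 where "f2 = (\<lambda>t. beta_kernel b b t *
    (\<Sum>n. pochhammer a n / fact n * of_real (-w) ^ n * of_real (1 - 2 * t) ^ n))"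
  have f1: "f1 t = beta_kernel b b t * of_real (1 - z * t) powr (-a)" if "0 < t" "t < 1" for t
  proof -
    have "z * t < 1" using z that mult_strict_mono[of z 1 t 1] by simp
    hence "norm (complex_of_real (z * t)) < 1" using z that by (simp only: norm_of_real) simp
    from sums_unique[OF binomial_series_sums[OF this, of a]]
    have "of_real (1 - z * t) powr (-a) = (\<Sum>n. pochhammer a n / fact n * of_real (z * t) ^ n)"
      by simp
    moreover have "of_real (z * t) ^ n = (of_real z ^ n * of_real t ^ n :: complex)" for n
      by (simp add: power_mult_distrib)
    ultimately show ?thesis by (simp only: f1_def mult.assoc)
  qed
  have f2: "f2 t = beta_kernel b b t * of_real (1 + w * (1 - 2 * t)) powr (-a)"
    if "0 < t" "t < 1" for t
  proof -
    have "\<bar>1 - 2 * t\<bar> \<le> 1" using that by auto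
    hence "\<bar>w * (1 - 2 * t)\<bar> < 1" using w unfolding abs_mult
      using mult_left_le[of "\<bar>1 - 2 * t\<bar>" "\<bar>w\<bar>"] by simp
    hence "norm (complex_of_real (- (w * (1 - 2 * t)))) < 1" by (simp only: norm_of_real abs_minus_cancel)
    from sums_unique[OF binomial_series_sums[OF this, of a]]
    have "of_real (1 + w * (1 - 2 * t)) powr (-a) =
        (\<Sum>n. pochhammer a n / fact n * of_real (- (w * (1 - 2 * t))) ^ n)" by simp
    moreover have "of_real (- (w * (1 - 2 * t))) ^ n = (of_real (- w) ^ n * of_real (1 - 2 * t) ^ n :: complex)" for n
      by (metis mult_minus_left of_real_mult power_mult_distrib)
    ultimately show ?thesis by (simp only: f2_def mult.assoc)
  qed
  have "integral {0<..<1} f1 = integral {0<..<1} (\<lambda>t. of_real (1 + w) powr a * f2 t)"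
  proof (rule integral_cong)
    fix t :: real assume t: "t \<in> {0<..<1}"
    have "z * t < 1" using z t mult_strict_mono[of z 1 t 1] by simp
    moreover have "1 + w * (1 - 2 * t) = (1 + w) * (1 - z * t)"
      using w by (simp add: z_def field_simps)
    ultimately have "of_real (1 + w * (1 - 2 * t)) powr (-a) =
        (of_real (1 + w) powr (-a) * of_real (1 - z * t) powr (-a) :: complex)"
      using w by (simp add: powr_times_real del: of_real_diff of_real_add)
    thus "f1 t = of_real (1 + w) powr a * f2 t"
      using t w by (simp add: f1 f2 powr_minus field_simps del: of_real_add)
  qed
  hence int_eq: "integral {0<..<1} f1 = of_real (1 + w) powr a * integral {0<..<1} f2"
    by simp
  have S1: "(\<lambda>n. pochhammer a n / fact n * of_real z ^ n *
            (Beta b b * pochhammer b n / pochhammer (b + b) n)) sums integral {0<..<1} f1"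
    unfolding f1_def using z b
    by (intro absolutely_integrable_beta_series(2) has_integral_beta_kernel_power
          summable_norm_binomial_series) auto
  have S2: "(\<lambda>n. Beta b b * (pochhammer a n * pochhammer b n /
       (pochhammer (2 * b) n * of_nat (fact n)) * of_real z ^ n)) sums
        (Beta b b * hyp2F1 a b (2 * b) (of_real z))"
    using z nz by (intro sums_mult hyp2F1_sums) auto
  have F1: "integral {0<..<1} f1 = Beta b b * hyp2F1 a b (2 * b) (of_real z)"
    by (rule sums_unique2[OF S1]) (use S2 in \<open>simp add: mult_ac mult_2\<close>)
  have "(\<lambda>n. pochhammer a n / fact n * of_real (-w) ^ n * beta_moment b n)
          sums integral {0<..<1} f2"
    unfolding f2_def using w b
    by (intro absolutely_integrable_beta_series(2) has_integral_beta_moment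
          summable_norm_binomial_series) auto
  \<comment> \<open>The odd moments are zero, so the series may be summed over n = 2p alone.\<close>
  hence S3: "(\<lambda>p. pochhammer a (2 * p) / fact (2 * p) * of_real (-w) ^ (2 * p) * beta_moment b (2 * p))
          sums integral {0<..<1} f2"
  proof (subst sums_mono_reindex)
    show "strict_mono ((*) (2 :: nat))" by (simp add: strict_mono_def)
    show "pochhammer a n / fact n * of_real (-w) ^ n * beta_moment b n = 0"
      if "n \<notin> range ((*) 2)" for n
    proof -
      have "odd n" using that by (auto elim: evenE)
      thus ?thesis by (simp add: beta_moment_def)
    qed
  qed
  \<comment> \<open>The duplication formulas for \<open>pochhammer a (2 * p)\<close> and
    \<open>fact (2 * p)\<close> both produce 4^p, which cancels; the Pochhammer symbol of 1/2 from
    the factorial cancels the one in the moment.\<close>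
  have even_term: "pochhammer a (2 * p) / fact (2 * p) * of_real (-w) ^ (2 * p) * beta_moment b (2 * p) =
      Beta b b * (pochhammer (a / 2) p * pochhammer (a / 2 + 1/2) p /
       (pochhammer (b + 1/2) p * of_nat (fact p)) * of_real (w\<^sup>2) ^ p)" for p
  proof -
    have "(1/2 :: complex) \<notin> \<int>\<^sub>\<le>\<^sub>0" by (intro Re_pos_notin_nonpos_Ints) simp
    hence "pochhammer (1/2 :: complex) p \<noteq> 0" using pochhammer_eq_0_imp_nonpos_Int by blast
    thus ?thesis
      using pochhammer_double[of "a / 2" p] fact_double[where ?'a = complex, of p]
      by (simp add: beta_moment_def power_mult) (simp add: mult_ac)
  qed
  have "w\<^sup>2 < 1" using w by (simp add: abs_square_less_1)
  hence "norm (complex_of_real (w\<^sup>2)) < 1" by (simp only: norm_of_real abs_power2)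
  hence S4: "(\<lambda>p. Beta b b * (pochhammer (a / 2) p * pochhammer (a / 2 + 1/2) p /
       (pochhammer (b + 1/2) p * of_nat (fact p)) * of_real (w\<^sup>2) ^ p)) sums
        (Beta b b * hyp2F1 (a / 2) (a / 2 + 1/2) (b + 1/2) (of_real (w\<^sup>2)))"
    using nz by (intro sums_mult hyp2F1_sums) auto
  have F2: "integral {0<..<1} f2 =
      Beta b b * hyp2F1 (a / 2) (a / 2 + 1/2) (b + 1/2) (of_real (w\<^sup>2))"
    by (rule sums_unique2[OF S3[unfolded even_term] S4])
  have "Beta b b \<noteq> 0"
    using nz by (simp add: Beta_def Gamma_eq_zero_iff flip: mult_2)
  thus ?thesis using int_eq F1 F2 by (simp add: z_def)
qed

section \<open>The real hyperbolic resolvent kernel in terms of cosh \<rho>\<close>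

lemma of_real_powr_exp:
  "y > 0 \<Longrightarrow> complex_of_real y powr s = exp (s * of_real (ln y))"
  by (simp add: powr_def Ln_of_real)

text \<open>With n = m + k + 1, \<open>sigmaX m k\<close> equals (n - 1)/2, so the parameters of
  \<open>R_Y\<close> are a = 2\<alpha>, b = 1/2 - i\<lambda> and 2b, as the quadratic transformation
  requires; Re b > 0 follows from Im \<lambda> \<ge> 0. Duplication splits Gamma (2\<alpha>) to
  match the Gamma factors of \<open>C_X\<close>.\<close>

lemma R_Y_eq_hyp2F1_cosh:
  fixes m k :: nat and lam :: complex
  assumes lam: "Im lam \<ge> 0" and \<sigma>: "m + k > 0" and \<rho>: "\<rho> > 0"
  defines "\<alpha> \<equiv> (of_real (sigmaX m k) - \<i> * lam) / 2"
  shows "R_Y (m + k + 1) lam \<rho> =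
     of_real (pi powr (- (sigmaX m k + 1/2))) * Gamma \<alpha> * Gamma (\<alpha> + 1/2) / (4 * Gamma (1 - \<i> * lam)) *
     of_real (cosh \<rho>) powr (- (2 * \<alpha>)) *
     hyp2F1 \<alpha> (\<alpha> + 1/2) (1 - \<i> * lam) (of_real (1 / (cosh \<rho>)\<^sup>2))"
proof -
  define w where "w = 1 / cosh \<rho>"
  define a where "a = 2 * \<alpha>"
  have c1: "cosh \<rho> > 1" using cosh_real_strict_mono[of 0 \<rho>] \<rho> by simp
  hence w: "0 < w" "w < 1" by (auto simp: w_def)
  have a: "a = of_real (sigmaX m k) - \<i> * lam" "\<alpha> = a / 2" by (simp_all add: a_def \<alpha>_def)
  have Re_a: "Re a > 0"
  proof -
    have "real m + real k > 0" using \<sigma> by linarith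
    thus ?thesis using lam by (simp add: a sigmaX_def add_pos_nonneg)
  qed
  have c2: "(cosh (\<rho> / 2))\<^sup>2 = (cosh \<rho> + 1) / 2"
    using cosh_double_cosh[of "\<rho> / 2"] by simp
  have c3: "(cosh (\<rho> / 2))\<^sup>2 = (1 + w) / (2 * w)"
    using c1 by (simp add: c2 w_def field_simps)
  have F: "hyp2F1 a (1/2 - \<i> * lam) (2 * (1/2 - \<i> * lam)) (of_real (2 * w / (1 + w))) =
       of_real (1 + w) powr a * hyp2F1 (a / 2) (a / 2 + 1/2) (1/2 - \<i> * lam + 1/2) (of_real (w\<^sup>2))"
    using lam w by (intro hyp2F1_quadratic) auto
  \<comment> \<open>Since (cosh (\<rho>/2))^2 = (1 + w)/(2w), the left side is (2w)^a with w = 1 /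
    cosh \<rho>. The identity is checked on logarithms.\<close>
  have P: "of_real (cosh (\<rho> / 2)) powr (- (2 * a)) * of_real (1 + w) powr a =
      2 powr a * (of_real (cosh \<rho>) powr (- a) :: complex)"
  proof -
    have "2 * ln (cosh (\<rho> / 2)) = ln ((cosh (\<rho> / 2))\<^sup>2)" by (simp add: ln_realpow)
    also have "\<dots> = ln (1 + w) - ln 2 - ln w" using w by (simp add: c3 ln_div ln_mult)
    finally have L: "ln (cosh (\<rho> / 2)) = (ln (1 + w) - ln 2 - ln w) / 2" by simp
    have "ln (cosh \<rho>) = - ln w" by (simp add: w_def ln_div)
    moreover have "2 powr a = exp (a * complex_of_real (ln 2))"
      using of_real_powr_exp[of 2 a] by simp
    moreover have "1 + w > 0" using w by simp
    ultimately show ?thesis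
      by (simp add: of_real_powr_exp L flip: exp_add del: of_real_add) (simp add: field_simps)
  qed
  have "Gamma \<alpha> * Gamma (\<alpha> + 1/2) = exp ((1 - 2 * \<alpha>) * of_real (ln 2)) * of_real (sqrt pi) * Gamma (2 * \<alpha>)"
    using Re_a by (intro Gamma_legendre_duplication Re_pos_notin_nonpos_Ints) (auto simp: a(2))
  hence LG: "Gamma \<alpha> * Gamma (\<alpha> + 1/2) = 2 powr (1 - a) * of_real (sqrt pi) * Gamma a"
    using of_real_powr_exp[of 2 "1 - a"] by (simp add: a_def)
  have "pi powr (- (sigmaX m k + 1/2)) * pi powr (1/2) = pi powr (- sigmaX m k)"
    by (simp flip: powr_add)
  hence PI: "of_real (pi powr (- sigmaX m k)) =
      of_real (pi powr (- (sigmaX m k + 1/2))) * complex_of_real (sqrt pi)"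
    by (simp add: powr_half_sqrt flip: of_real_mult)
  \<comment> \<open>The power of 2 in \<open>C_Y\<close> meets the 2^a from \<open>P\<close>;
    comparison with the 2^(1 - a) of the duplication formula leaves the factor 1/4.\<close>
  have TWO: "2 powr (- (2 * a + 1)) * 2 powr a = (2 powr (1 - a) / 4 :: complex)"
  proof -
    have "2 powr (- (2 * a + 1)) * 2 powr a = (2 powr (1 - a + (- 2)) :: complex)"
      by (simp add: algebra_simps flip: powr_add)
    also have "\<dots> = 2 powr (1 - a) * 2 powr (-2)" by (rule powr_add)
    finally show ?thesis by (simp add: powr_minus)
  qed
  have args: "of_nat (m + k + 1) - 2 * \<i> * lam = 2 * a + 1"
    "(of_nat (m + k + 1) - 1) / 2 - \<i> * lam = a"
    "2 * \<i> * lam - (of_nat (m + k + 1) - 1) = - (2 * a)"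
    "- (real (m + k + 1) - 1) / 2 = - sigmaX m k"
    "1 - 2 * \<i> * lam = 2 * (1/2 - \<i> * lam)"
    "1 / (cosh (\<rho> / 2))\<^sup>2 = 2 * w / (1 + w)"
    by (simp_all add: a sigmaX_def c3 field_simps)
  have args': "1/2 - \<i> * lam + 1/2 = 1 - \<i> * lam" "w\<^sup>2 = 1 / (cosh \<rho>)\<^sup>2"
    by (simp_all add: w_def power_divide)
  have alg: "A * B * G / D * C * (E * H) = B' * Ga * Gb / (4 * D) * K * H"
    if "C * E = T * K" "A * T = U / 4" "B = B' * S" "Ga * Gb = U * S * G"
    for A B G D C E H B' Ga Gb K T U S :: complex
  proof -
    have "A * B * G / D * C * (E * H) = A * B * G / D * (C * E) * H" by simp
    also have "\<dots> = (A * T) * B * G / D * K * H" unfolding that(1) by simp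
    also have "\<dots> = B' * (U * S * G) / (4 * D) * K * H" unfolding that(2,3) by simp
    finally show ?thesis unfolding that(4)[symmetric] by simp
  qed
  show ?thesis
    unfolding R_Y_def C_Y_def args F args' a(2)[symmetric] a_def[symmetric]
    by (rule alg[OF P TWO PI LG])
qed

section \<open>The integral transform\<close>

text \<open>The n-th moment of the kernel contributes (a)_n / (a + d)_n, which trades the parameter
  a + d for a. Absolute integrability is recorded for the change of variables that follows.\<close>

lemma beta_kernel_hyp2F1_integral:
  fixes a a' c d :: complex and x :: real
  assumes a: "Re a > 0" and d: "Re d > 0" and c: "c \<notin> \<int>\<^sub>\<le>\<^sub>0" and x: "0 \<le> x" "x < 1"
  defines "f \<equiv> \<lambda>t. beta_kernel a d t * hyp2F1 a' (a + d) c (of_real (x * t))"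
  shows "f absolutely_integrable_on {0<..<1}"
    and "integral {0<..<1} f = Beta a d * hyp2F1 a' a c (of_real x)"
proof -
  define e where "e = (\<lambda>n. pochhammer a' n * pochhammer (a + d) n / (pochhammer c n * of_nat (fact n)) * of_real x ^ n)"
  have x1: "norm (complex_of_real x) < 1" using x by simp
  have e: "summable (\<lambda>n. norm (e n))"
    unfolding e_def by (rule summable_norm_hyp2F1[OF c x1])
  have f: "f = (\<lambda>t. beta_kernel a d t * (\<Sum>n. e n * of_real t ^ n))"
    by (simp add: f_def e_def hyp2F1_def power_mult_distrib mult.assoc)
  note series = absolutely_integrable_beta_series[OF a d e _ has_integral_beta_kernel_power[OF a d],
      folded f]
  show "f absolutely_integrable_on {0<..<1}"
    by (rule series(1)) auto
  have "(\<lambda>n. e n * (Beta a d * pochhammer a n / pochhammer (a + d) n)) sums integral {0<..<1} f"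
    by (rule series(2)) auto
  moreover have "e n * (Beta a d * pochhammer a n / pochhammer (a + d) n) =
      Beta a d * (pochhammer a' n * pochhammer a n / (pochhammer c n * of_nat (fact n)) * of_real x ^ n)" for n
  proof -
    have "a + d \<notin> \<int>\<^sub>\<le>\<^sub>0" using a d by (intro Re_pos_notin_nonpos_Ints) simp
    hence "pochhammer (a + d) n \<noteq> 0" using pochhammer_eq_0_imp_nonpos_Int by blast
    thus ?thesis by (simp add: e_def)
  qed
  ultimately have "(\<lambda>n. Beta a d * (pochhammer a' n * pochhammer a n /
      (pochhammer c n * of_nat (fact n)) * of_real x ^ n)) sums integral {0<..<1} f"
    by simp
  moreover have "(\<lambda>n. Beta a d * (pochhammer a' n * pochhammer a n /
      (pochhammer c n * of_nat (fact n)) * of_real x ^ n)) sums (Beta a d * hyp2F1 a' a c (of_real x))"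
    by (intro sums_mult hyp2F1_sums c x1)
  ultimately show "integral {0<..<1} f = Beta a d * hyp2F1 a' a c (of_real x)"
    by (rule sums_unique2)
qed

text \<open>Change of variables t = (cosh r)^2 / (cosh \<rho>)^2, a decreasing bijection from (r,
  \<infinity>) onto (0, 1). Its derivative \<open>h\<close> is negative, so the weight is
  -h.\<close>

lemma has_integral_cosh_substitution:
  fixes f :: "real \<Rightarrow> complex" and r :: real
  assumes r: "r > 0" and f: "f absolutely_integrable_on {0<..<1}"
  shows "((\<lambda>\<rho>. of_real (2 * (cosh r)\<^sup>2 * sinh \<rho> / cosh \<rho> ^ 3) * f ((cosh r)\<^sup>2 / (cosh \<rho>)\<^sup>2))
           has_integral integral {0<..<1} f) {r<..}"
proof -
  define g where "g = (\<lambda>\<rho>. (cosh r)\<^sup>2 / (cosh \<rho>)\<^sup>2)"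
  define h where "h = (\<lambda>\<rho>. - (2 * (cosh r)\<^sup>2 * sinh \<rho> / cosh \<rho> ^ 3))"
  have less: "cosh r < cosh \<rho>" if "\<rho> > r" for \<rho>
    using cosh_real_strict_mono[of r \<rho>] that r by simp
  have der: "(g has_field_derivative h \<rho>) (at \<rho> within {r<..})" for \<rho>
    unfolding g_def h_def
    by (auto intro!: derivative_eq_intros simp: field_simps power2_eq_square power3_eq_cube)
  have inj: "inj_on g {r<..}"
  proof (rule inj_onI)
    fix u v assume uv: "u \<in> {r<..}" "v \<in> {r<..}" "g u = g v"
    hence "(cosh u)\<^sup>2 = (cosh v)\<^sup>2" by (simp add: g_def)
    hence "cosh u = cosh v" by (simp add: power2_eq_iff_nonneg)
    thus "u = v" using uv r cosh_real_strict_mono[of u v] cosh_real_strict_mono[of v u]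
      by (cases u v rule: linorder_cases) auto
  qed
  have image: "g ` {r<..} = {0<..<1}"
  proof (intro equalityI subsetI)
    fix t assume "t \<in> g ` {r<..}"
    then obtain \<rho> where "\<rho> > r" "t = g \<rho>" by auto
    thus "t \<in> {0<..<1}" using less[of \<rho>] by (simp add: g_def power_strict_mono)
  next
    fix t :: real assume t: "t \<in> {0<..<1}"
    \<comment> \<open>The value that cosh \<rho> must take for \<open>g \<rho> = t\<close>; it
      exceeds cosh r because t < 1.\<close>
    define y where "y = cosh r / sqrt t"
    have y: "y > cosh r" using t by (simp add: y_def field_simps)
    have y1: "y \<ge> 1" using y cosh_real_ge_1[of r] by linarith
    have "cosh (arcosh y) = y" using y1 by simp
    moreover have "arcosh y > r"
    proof (rule ccontr)
      assume "\<not> arcosh y > r"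
      moreover have "arcosh y \<ge> 0" using y1 by simp
      ultimately have "cosh (arcosh y) \<le> cosh r" using r by (simp add: cosh_real_nonneg_le_iff)
      thus False using y y1 by simp
    qed
    moreover have "(cosh r)\<^sup>2 / y\<^sup>2 = t" using t by (simp add: y_def power_divide)
    ultimately show "t \<in> g ` {r<..}" by (intro image_eqI[of _ _ "arcosh y"]) (auto simp: g_def)
  qed
  have "(\<lambda>\<rho>. \<bar>h \<rho>\<bar> *\<^sub>R f (g \<rho>)) absolutely_integrable_on {r<..} \<and>
      integral {r<..} (\<lambda>\<rho>. \<bar>h \<rho>\<bar> *\<^sub>R f (g \<rho>)) = integral {0<..<1} f"
    using has_absolute_integral_change_of_variables_real[OF _ der inj, of f "integral {0<..<1} f"] f
    by (simp add: image)
  hence "((\<lambda>\<rho>. \<bar>h \<rho>\<bar> *\<^sub>R f (g \<rho>)) has_integral integral {0<..<1} f) {r<..}"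
    using set_lebesgue_integral_eq_integral(1) by (metis has_integral_integral)
  thus ?thesis
    by (rule has_integral_eq[rotated]) (use r in \<open>simp add: h_def g_def scaleR_conv_of_real abs_mult\<close>)
qed

lemma of_real_powr_real_exp:
  "y > 0 \<Longrightarrow> complex_of_real (y powr s) = exp (of_real s * of_real (ln y))"
  by (simp add: powr_def flip: exp_of_real of_real_mult)

text \<open>Here x = cosh r, y = cosh \<rho>, and x^2 / y^3 is the Jacobian without 2 sinh \<rho>.
  With 1 - t = (y^2 - x^2)/y^2, the powers of x on the right add up to -2 \<open>betaX k\<close> = 1
  - k and those of y to -2\<alpha>.\<close>

lemma beta_kernel_cosh:
  fixes x y :: real and k :: nat
  assumes xy: "0 < x" "x < y"
  shows "of_real (x powr (1 - real k) * (y\<^sup>2 - x\<^sup>2) powr ((real k - 2) / 2)) * of_real y powr (- (2 * \<alpha>)) =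
         of_real x powr (- (2 * \<alpha>)) * of_real (x\<^sup>2 / y ^ 3) *
           beta_kernel (\<alpha> - of_real (betaX k)) (of_nat k / 2) (x\<^sup>2 / y\<^sup>2)"
proof -
  have pos: "y > 0" "y\<^sup>2 - x\<^sup>2 > 0" "1 - x\<^sup>2 / y\<^sup>2 > 0" "x\<^sup>2 / y\<^sup>2 > 0"
    using xy by (auto simp: power_strict_mono field_simps)
  have ln1: "ln (x\<^sup>2 / y\<^sup>2) = 2 * ln x - 2 * ln y"
    using xy by (simp add: ln_div ln_realpow)
  have "1 - x\<^sup>2 / y\<^sup>2 = (y\<^sup>2 - x\<^sup>2) / y\<^sup>2" using pos by (simp add: field_simps)
  hence ln2: "ln (1 - x\<^sup>2 / y\<^sup>2) = ln (y\<^sup>2 - x\<^sup>2) - 2 * ln y"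
    using pos by (simp add: ln_div ln_realpow)
  have pre: "complex_of_real (x\<^sup>2 / y ^ 3) = exp (2 * of_real (ln x) - 3 * of_real (ln y))"
  proof -
    have "x\<^sup>2 / y ^ 3 = exp (2 * ln x - 3 * ln y)"
      using xy exp_of_nat_mult[of 2 "ln x"] exp_of_nat_mult[of 3 "ln y"] by (simp add: exp_diff)
    thus ?thesis by (simp flip: exp_of_real)
  qed
  show ?thesis
    unfolding of_real_mult of_real_powr_real_exp[OF xy(1)] of_real_powr_real_exp[OF pos(2)]
      of_real_powr_exp[OF xy(1)] of_real_powr_exp[OF pos(1)] pre beta_kernel_def
      of_real_powr_exp[OF pos(3)] of_real_powr_exp[OF pos(4)] ln1 ln2 exp_add[symmetric]
    by (rule arg_cong[of _ _ exp]) (simp add: betaX_def field_simps)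
qed

theorem theorem1p1:
  fixes m k :: nat and lam :: complex and r :: real
  assumes "htype_dims m k"
    and "Im lam \<ge> 0"
    and "r > 0"
  shows "((\<lambda>\<rho>. of_real (W_X k r \<rho>) * R_Y (m + k + 1) lam \<rho> * of_real (sinh \<rho>))
           has_integral R_X m k lam r) {r<..}"
proof -
  define \<alpha> where "\<alpha> = (of_real (sigmaX m k) - \<i> * lam) / 2"
  define a where "a = \<alpha> - of_real (betaX k)"
  define d where "d = complex_of_nat k / 2"
  define c where "c = 1 - \<i> * lam"
  define x where "x = cosh r"
  define A where "A = of_real (pi powr (- (sigmaX m k + 1/2))) * Gamma \<alpha> * Gamma (\<alpha> + 1/2) / (4 * Gamma c)"
  have mk: "1 \<le> k" "k < m" using assms(1) by (auto simp: htype_dims_def)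
  have x1: "x > 1" using cosh_real_strict_mono[of 0 r] assms(3) by (simp add: x_def)
  have ad: "a + d = \<alpha> + 1/2" by (simp add: a_def d_def betaX_def field_simps)
  \<comment> \<open>Re a = (m - k + 2)/4 + (Im \<lambda>)/2, positive because k < m.\<close>
  have Re_a: "Re a > 0" using mk assms(2) by (simp add: a_def \<alpha>_def betaX_def sigmaX_def field_simps)
  have Re_d: "Re d > 0" using mk by (simp add: d_def)
  have c: "c \<notin> \<int>\<^sub>\<le>\<^sub>0" using assms(2) by (intro Re_pos_notin_nonpos_Ints) (simp add: c_def)
  define f where "f = (\<lambda>t. beta_kernel a d t * hyp2F1 \<alpha> (a + d) c (of_real (1 / x\<^sup>2 * t)))"
  have f: "f absolutely_integrable_on {0<..<1}"
      "integral {0<..<1} f = Beta a d * hyp2F1 \<alpha> a c (of_real (1 / x\<^sup>2))"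
    unfolding f_def using x1
    by (intro beta_kernel_hyp2F1_integral Re_a Re_d c; simp add: power_gt1_lemma one_less_power)+
  \<comment> \<open>Collects the factors independent of \<rho>. The factor 2 of \<open>W_X\<close>
    is left out because the derivative of the substitution supplies it.\<close>
  define D where "D = of_real (pi powr (real k / 2) / Gamma (real k / 2)) * A * of_real x powr (- (2 * \<alpha>))"
  have "((\<lambda>\<rho>. D * (of_real (2 * (cosh r)\<^sup>2 * sinh \<rho> / cosh \<rho> ^ 3) * f ((cosh r)\<^sup>2 / (cosh \<rho>)\<^sup>2)))
          has_integral D * (Beta a d * hyp2F1 \<alpha> a c (of_real (1 / x\<^sup>2)))) {r<..}"
    unfolding f(2)[symmetric]
    by (intro has_integral_mult_right has_integral_cosh_substitution assms f)
  moreover have "D * (of_real (2 * (cosh r)\<^sup>2 * sinh \<rho> / cosh \<rho> ^ 3) * f ((cosh r)\<^sup>2 / (cosh \<rho>)\<^sup>2)) =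
      of_real (W_X k r \<rho>) * R_Y (m + k + 1) lam \<rho> * of_real (sinh \<rho>)"
    if "\<rho> \<in> {r<..}" for \<rho>
  proof -
    define y where "y = cosh \<rho>"
    have xy: "0 < x" "x < y" using x1 cosh_real_strict_mono[of r \<rho>] that assms(3) by (auto simp: x_def y_def)
    let ?H = "hyp2F1 \<alpha> (\<alpha> + 1/2) c (of_real (1 / y\<^sup>2))"
    let ?K = "beta_kernel a d (x\<^sup>2 / y\<^sup>2)"
    have "f (x\<^sup>2 / y\<^sup>2) = ?K * ?H"
      using xy by (simp add: f_def ad)
    hence "D * (of_real (2 * x\<^sup>2 * sinh \<rho> / y ^ 3) * f (x\<^sup>2 / y\<^sup>2)) =
       2 * of_real (pi powr (real k / 2) / Gamma (real k / 2)) * A *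
       (of_real x powr (- (2 * \<alpha>)) * of_real (x\<^sup>2 / y ^ 3) * ?K) * ?H * of_real (sinh \<rho>)"
      by (simp add: D_def)
    also have "of_real x powr (- (2 * \<alpha>)) * of_real (x\<^sup>2 / y ^ 3) * ?K =
       of_real (x powr (1 - real k) * (y\<^sup>2 - x\<^sup>2) powr ((real k - 2) / 2)) * of_real y powr (- (2 * \<alpha>))"
      using beta_kernel_cosh[OF xy, of k \<alpha>] by (simp only: a_def d_def)
    also have "2 * of_real (pi powr (real k / 2) / Gamma (real k / 2)) * A *
       (of_real (x powr (1 - real k) * (y\<^sup>2 - x\<^sup>2) powr ((real k - 2) / 2)) * of_real y powr (- (2 * \<alpha>))) *
       ?H * of_real (sinh \<rho>) = of_real (W_X k r \<rho>) * (A * of_real y powr (- (2 * \<alpha>)) * ?H) * of_real (sinh \<rho>)"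
      by (simp add: W_X_def x_def y_def)
    also have "A * of_real y powr (- (2 * \<alpha>)) * ?H = R_Y (m + k + 1) lam \<rho>"
      using R_Y_eq_hyp2F1_cosh[of lam m k \<rho>] assms that mk by (simp add: A_def c_def y_def \<alpha>_def)
    finally show ?thesis by (simp only: x_def y_def)
  qed
  ultimately have "((\<lambda>\<rho>. of_real (W_X k r \<rho>) * R_Y (m + k + 1) lam \<rho> * of_real (sinh \<rho>))
      has_integral D * (Beta a d * hyp2F1 \<alpha> a c (of_real (1 / x\<^sup>2)))) {r<..}"
    by (metis (no_types, lifting) has_integral_eq)
  moreover have "D * (Beta a d * hyp2F1 \<alpha> a c (of_real (1 / x\<^sup>2))) = R_X m k lam r"
  proof -
    have nz: "Gamma d \<noteq> 0" "Gamma (\<alpha> + 1/2) \<noteq> 0"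
      using Re_a Re_d by (auto simp: Gamma_eq_zero_iff Re_pos_notin_nonpos_Ints simp flip: ad)
    have Gd: "complex_of_real (Gamma (real k / 2)) = Gamma d"
      by (simp add: d_def flip: Gamma_complex_of_real)
    have P: "pi powr (real k / 2) * pi powr (- (sigmaX m k + 1/2)) = pi powr (- (real m + 1) / 2)"
      by (simp add: sigmaX_def field_simps flip: powr_add)
    have CX: "C_X m k lam = of_real (pi powr (- (real m + 1) / 2)) * Gamma \<alpha> * Gamma a / (4 * Gamma c)"
      by (simp add: C_X_def \<alpha>_def a_def c_def)
    have e: "- of_real (sigmaX m k) + \<i> * lam = - (2 * \<alpha>)" by (simp add: \<alpha>_def field_simps)
    \<comment> \<open>In \<open>Beta a d\<close>, the factor Gamma d cancels the normalisation of
      \<open>W_X\<close>, and the denominator Gamma (\<alpha> + 1/2) cancels against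
      \<open>A\<close>. What remains is Gamma \<alpha> * Gamma a, as in \<open>C_X\<close>.\<close>
    have "D * Beta a d = C_X m k lam * of_real x powr (- (2 * \<alpha>))"
      unfolding CX P[symmetric] D_def A_def Beta_def ad of_real_divide of_real_mult Gd
      using nz by simp
    thus ?thesis
      unfolding R_X_def e by (simp add: \<alpha>_def[symmetric] a_def[symmetric] c_def[symmetric] x_def[symmetric])
  qed
  ultimately show ?thesis by simp
qed

end
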